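(* Let $l,T>0$, $\bar Q_T=\{(x,t):0\le x\le l,\ 0\le t\le T\}$, and let $\alpha:(0,l)\to(0,1)$ be continuous. Suppose $k\in C^{1,0}(\bar Q_T)$, $q,f\in C(\bar Q_T)$, $k(x,t)\ge c_1>0$ and $q(x,t)\ge0$ everywhere on $\bar Q_T$, and $\beta_i,\mu_i\in C[0,T]$ with $\beta_i(t)\ge\beta_0>0$ for all $t\in[0,T]$, $i=1,2$. Let $u\in C^{2,1}(\bar Q_T)$ be a solution of the problem $$\partial_{0t}^{\alpha(x)}u=\frac{\partial}{\partial x}\left(k(x,t)\frac{\partial u}{\partial x}\right)-q(x,t)u+f(x,t),\quad 0<x<l,\ 0<t\le T,$$ $$k(0,t)u_x(0,t)=\beta_1(t)u(0,t)-\mu_1(t),\qquad -k(l,t)u_x(l,t)=\beta_2(t)u(l,t)-\mu_2(t),\quad 0\le t\le T,$$ $$u(x,0)=u_0(x),\quad 0\le x\le l.$$ Then for all $t\in[0,T]$ the following a priori estimate holds: $$\int_0^l D_{0t}^{\alpha(x)-1}u^2(x,t)\,dx+\gamma\int_0^t\left(\|u_x(x,s)\|_0^2+u^2(0,s)+u^2(l,s)\right)ds$$ $$\le\frac{\delta}{\gamma}\int_0^t\left(\|f(x,s)\|_0^2+\mu_1^2(s)+\mu_2^2(s)\right)ds+\int_0^l\frac{t^{1-\alpha(x)}}{\Gamma(2-\alpha(x))}u_0^2(x)\,dx,$$ where $\gamma=\min\{c_1,\beta_0\}$ and $\delta=\max\{1+l,l^2\}$.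
   Context: $C^{m,n}(\bar Q_T)$ is the class of functions continuous on $\bar Q_T$ together with their partial derivatives of order $m$ with respect to $x$ and of order $n$ with respect to $t$. The Caputo derivative of (variable) order $\alpha(x)\in(0,1)$ is $\partial_{0t}^{\alpha(x)}u(x,t)=\frac{1}{\Gamma(1-\alpha(x))}\int_0^t u_\tau(x,\tau)(t-\tau)^{-\alpha(x)}\,d\tau$. For $\beta>0$, the Riemann--Liouville fractional integral of order $\beta$ is $D_{0t}^{-\beta}u(x,t)=\frac1{\Gamma(\beta)}\int_0^t(t-s)^{\beta-1}u(x,s)\,ds$; thus $D_{0t}^{\alpha(x)-1}$ is the fractional integral of order $1-\alpha(x)$, applied in $t$ for each fixed $x$. For a function $v(x,t)$, $\|v(x,t)\|_0^2=\int_0^l v^2(x,t)\,dx$ (a function of $t$). *)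

theory Defs
  imports "HOL-Analysis.Analysis"
begin

definition rect :: "real \<Rightarrow> real \<Rightarrow> (real \<times> real) set" where
  "rect l T = {0..l} \<times> {0..T}"

text \<open>Partial derivatives of functions given on the closed rectangle are taken within it,
  i.e. they are one-sided on the boundary and the usual ones in the interior.\<close>

definition Dx :: "real \<Rightarrow> (real \<Rightarrow> real \<Rightarrow> real) \<Rightarrow> real \<Rightarrow> real \<Rightarrow> real" where
  "Dx l u = (\<lambda>x t. vector_derivative (\<lambda>y. u y t) (at x within {0..l}))"

definition Dt :: "real \<Rightarrow> (real \<Rightarrow> real \<Rightarrow> real) \<Rightarrow> real \<Rightarrow> real \<Rightarrow> real" where
  "Dt T u = (\<lambda>x t. vector_derivative (\<lambda>s. u x s) (at t within {0..T}))"

text \<open>The class \<open>C\<^sup>m\<^sup>,\<^sup>n\<close> on the closed rectangle: the pure partial derivatives up to order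
  \<open>m\<close> in \<open>x\<close> and up to order \<open>n\<close> in \<open>t\<close> exist and are jointly continuous; no mixed derivatives
  are involved.\<close>

definition C_class :: "real \<Rightarrow> real \<Rightarrow> nat \<Rightarrow> nat \<Rightarrow> (real \<Rightarrow> real \<Rightarrow> real) set" where
  "C_class l T m n = {u.
     (\<forall>i<m. \<forall>(x, t)\<in>rect l T. (\<lambda>y. (Dx l ^^ i) u y t) differentiable (at x within {0..l})) \<and>
     (\<forall>i\<le>m. continuous_on (rect l T) (\<lambda>(x, t). (Dx l ^^ i) u x t)) \<and>
     (\<forall>j<n. \<forall>(x, t)\<in>rect l T. (\<lambda>s. (Dt T ^^ j) u x s) differentiable (at t within {0..T})) \<and>
     (\<forall>j\<le>n. continuous_on (rect l T) (\<lambda>(x, t). (Dt T ^^ j) u x t))}"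

definition caputo ::
  "real \<Rightarrow> (real \<Rightarrow> real) \<Rightarrow> (real \<Rightarrow> real \<Rightarrow> real) \<Rightarrow> real \<Rightarrow> real \<Rightarrow> real" where
  "caputo T \<alpha> u x t =
     1 / Gamma (1 - \<alpha> x) * integral {0..t} (\<lambda>\<tau>. Dt T u x \<tau> * (t - \<tau>) powr (- \<alpha> x))"

text \<open>The Riemann--Liouville integral of order \<open>\<beta> x\<close>, taken in \<open>t\<close> for each fixed \<open>x\<close>;
  the operator with exponent \<open>\<alpha> x - 1\<close> is the case \<open>\<beta> x = 1 - \<alpha> x\<close>.\<close>

definition RL_integral ::
  "(real \<Rightarrow> real) \<Rightarrow> (real \<Rightarrow> real \<Rightarrow> real) \<Rightarrow> real \<Rightarrow> real \<Rightarrow> real" where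
  "RL_integral \<beta> u x t =
     1 / Gamma (\<beta> x) * integral {0..t} (\<lambda>s. (t - s) powr (\<beta> x - 1) * u x s)"

definition norm0_sq :: "real \<Rightarrow> (real \<Rightarrow> real \<Rightarrow> real) \<Rightarrow> real \<Rightarrow> real" where
  "norm0_sq l v t = integral {0..l} (\<lambda>x. (v x t)\<^sup>2)"

end

theory Submission
  imports Defs
begin

text \<open>Test the equation with \<open>2 u\<close> and integrate over \<open>(0, l) \<times> (0, t)\<close>. Alikhanov's inequality
  \<open>2 u \<partial>\<^sup>\<alpha> u \<ge> \<partial>\<^sup>\<alpha> (u\<^sup>2)\<close>, applied for each fixed \<open>x\<close>, produces the fractional integral of \<open>u\<^sup>2\<close> and
  the initial term after integration in time. In space, integration by parts and the boundary
  conditions give the energy \<open>\<parallel>u\<^sub>x\<parallel>\<^sup>2 + u\<^sup>2(0) + u\<^sup>2(l)\<close> with factor \<open>2 \<gamma>\<close>; half of it absorbs the right-hand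
  side by Young's inequality with parameter \<open>\<gamma> / \<delta>\<close>, because
  \<open>\<parallel>u\<parallel>\<^sup>2 + u\<^sup>2(0) + u\<^sup>2(l) \<le> \<delta> (\<parallel>u\<^sub>x\<parallel>\<^sup>2 + u\<^sup>2(0) + u\<^sup>2(l))\<close>. Since \<open>\<alpha>\<close> is controlled only inside \<open>(0, l)\<close>, the
  \<open>x\<close>-integrals of the fractional terms exist as integrals of bounded continuous functions on the
  open interval.\<close>

section \<open>Power kernels in time and Alikhanov's inequality\<close>

lemma kernel_has_real_derivative:
  fixes s r x :: real
  assumes "x < s"
  shows "((\<lambda>\<tau>. (s - \<tau>) powr r) has_real_derivative - (r * (s - x) powr (r - 1))) (at x)"
proof -
  have "((\<lambda>z. z powr r) has_real_derivative r * (s - x) powr (r - 1)) (at (s - x))"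
    using assms by (intro has_real_derivative_powr) auto
  moreover have "((\<lambda>\<tau>. s - \<tau>) has_real_derivative - 1) (at x)"
    by (auto intro!: derivative_eq_intros)
  ultimately show ?thesis
    using DERIV_chain2 by fastforce
qed

lemma has_real_derivative_interior:
  fixes x a b :: real
  assumes "(v has_vector_derivative d) (at x within {a..b})" "x \<in> {a<..<b}"
  shows "(v has_real_derivative d) (at x)"
  using assms at_within_Icc_at[of a x b]
  unfolding has_real_derivative_iff_has_vector_derivative by simp

text \<open>For positive \<open>a\<close> the integrand blows up near \<open>s\<close>. The
  antiderivative is still continuous up to \<open>s\<close>, so it is enough to differentiate it in
  the open interval; it vanishes at \<open>s\<close> because
  \<open>0 powr (1 - a) = 0\<close>.\<close>

lemma has_integral_kernel:
  fixes a s :: real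
  assumes "a < 1" "0 \<le> s"
  shows "((\<lambda>\<tau>. (s - \<tau>) powr - a) has_integral s powr (1 - a) / (1 - a)) {0..s}"
proof -
  have "((\<lambda>\<tau>. (s - \<tau>) powr - a) has_integral
      (- ((s - s) powr (1 - a) / (1 - a)) - - ((s - 0) powr (1 - a) / (1 - a)))) {0..s}"
  proof (rule fundamental_theorem_of_calculus_interior)
    show "continuous_on {0..s} (\<lambda>\<tau>. - ((s - \<tau>) powr (1 - a) / (1 - a)))"
      using assms by (intro continuous_intros continuous_on_powr') auto
    show "((\<lambda>\<tau>. - ((s - \<tau>) powr (1 - a) / (1 - a))) has_vector_derivative (s - x) powr - a) (at x)"
      if "x \<in> {0<..<s}" for x
      unfolding has_real_derivative_iff_has_vector_derivative[symmetric]
      using that assms DERIV_minus[OF DERIV_cdivide[OF kernel_has_real_derivative[of x s "1 - a"], of "1 - a"]]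
      by simp
  qed (use assms in auto)
  then show ?thesis using assms by simp
qed

text \<open>A continuous function on a compact interval is bounded and measurable, and the kernel is
  nonnegative and integrable.\<close>

lemma absolutely_integrable_kernel_mult:
  fixes a s :: real
  assumes "a < 1" "0 \<le> s" "continuous_on {0..s} \<phi>"
  shows "(\<lambda>\<tau>. \<phi> \<tau> * (s - \<tau>) powr - a) absolutely_integrable_on {0..s}"
proof (rule absolutely_integrable_bounded_measurable_product_real)
  show "\<phi> \<in> borel_measurable (lebesgue_on {0..s})"
    using assms by (intro continuous_imp_measurable_on_sets_lebesgue) auto
  show "bounded (\<phi> ` {0..s})"
    using assms by (intro compact_imp_bounded compact_continuous_image) auto
  show "(\<lambda>\<tau>. (s - \<tau>) powr - a) absolutely_integrable_on {0..s}"
    using has_integral_kernel[OF assms(1,2)]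
    by (intro nonnegative_absolutely_integrable_1) auto
qed auto

text \<open>The difference of the two integrands is the derivative of
  \<open>- ((t - s) powr (1 - a) / (1 - a) * v s)\<close>, whose boundary term at \<open>t\<close>
  vanishes as \<open>1 - a > 0\<close>. This trades the singular kernel for a continuous one. It is
  used for the initial term in the energy inequality and for the regularity in \<open>x\<close> of
  the fractional integral.\<close>

lemma kernel_by_parts:
  fixes a t :: real
  assumes "a < 1" "0 \<le> t"
    and v: "\<And>s. s \<in> {0..t} \<Longrightarrow> (v has_vector_derivative v' s) (at s within {0..t})"
    and v': "continuous_on {0..t} v'"
  shows "integral {0..t} (\<lambda>s. (t - s) powr - a * v s) =
    t powr (1 - a) / (1 - a) * v 0 + integral {0..t} (\<lambda>s. (t - s) powr (1 - a) / (1 - a) * v' s)"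
proof -
  have cv: "continuous_on {0..t} v"
    using v by (meson continuous_on_eq_continuous_within has_vector_derivative_continuous)
  have int: "(\<lambda>s. (t - s) powr (1 - a) / (1 - a) * v' s) integrable_on {0..t}"
    using assms by (intro integrable_continuous_real continuous_intros continuous_on_powr') auto
  have "((\<lambda>s. (t - s) powr - a * v s - (t - s) powr (1 - a) / (1 - a) * v' s) has_integral
      (- ((t - t) powr (1 - a) / (1 - a) * v t) - - ((t - 0) powr (1 - a) / (1 - a) * v 0))) {0..t}"
  proof (rule fundamental_theorem_of_calculus_interior)
    show "continuous_on {0..t} (\<lambda>\<tau>. - ((t - \<tau>) powr (1 - a) / (1 - a) * v \<tau>))"
      using assms by (intro continuous_intros continuous_on_powr' cv) auto
    show "((\<lambda>\<tau>. - ((t - \<tau>) powr (1 - a) / (1 - a) * v \<tau>)) has_vector_derivative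
        (t - x) powr - a * v x - (t - x) powr (1 - a) / (1 - a) * v' x) (at x)"
      if "x \<in> {0<..<t}" for x
    proof -
      have "(v has_real_derivative v' x) (at x)"
        using that by (intro has_real_derivative_interior[OF v]) auto
      have "((\<lambda>\<tau>. (t - \<tau>) powr (1 - a) / (1 - a)) has_real_derivative - ((t - x) powr - a)) (at x)"
        using that assms(1) DERIV_cdivide[OF kernel_has_real_derivative[of x t "1 - a"], of "1 - a"]
        by simp
      from DERIV_minus[OF DERIV_mult[OF this \<open>(v has_real_derivative v' x) (at x)\<close>]]
      show ?thesis
        unfolding has_real_derivative_iff_has_vector_derivative[symmetric]
        by (simp add: algebra_simps)
    qed
  qed (use assms in auto)
  from has_integral_add[OF this integrable_integral[OF int]]
  show ?thesis
    by (simp add: integral_unique)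
qed

text \<open>Up to the factor \<open>1 / Gamma (1 - a)\<close>, this is Alikhanov's inequality
  \<open>w \<partial>\<^sup>a w \<ge> \<partial>\<^sup>a (w\<^sup>2) / 2\<close>.\<close>

lemma kernel_Alikhanov:
  fixes a s :: real
  assumes a: "0 < a" "a < 1" and s: "0 \<le> s"
    and w: "\<And>\<tau>. \<tau> \<in> {0..s} \<Longrightarrow> (w has_vector_derivative w' \<tau>) (at \<tau> within {0..s})"
    and w': "continuous_on {0..s} w'"
  shows "integral {0..s} (\<lambda>\<tau>. w \<tau> * w' \<tau> * (s - \<tau>) powr - a)
    \<le> w s * integral {0..s} (\<lambda>\<tau>. w' \<tau> * (s - \<tau>) powr - a)"
proof -
  \<comment> \<open>\<open>\<Phi>\<close> vanishes at \<open>s\<close> and is nonpositive at \<open>0\<close>, and its derivative differs from the difference of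
    the two integrands only by the nonpositive second term of \<open>\<Phi>'\<close>.\<close>
  define h where "h \<tau> = (w s - w \<tau>)\<^sup>2 / 2" for \<tau>
  define \<Phi> where "\<Phi> \<tau> = - h \<tau> * (s - \<tau>) powr - a" for \<tau>
  define \<Phi>' where "\<Phi>' \<tau> = w' \<tau> * (w s - w \<tau>) * (s - \<tau>) powr - a - a * h \<tau> * (s - \<tau>) powr (- a - 1)" for \<tau>
  have cw: "continuous_on {0..s} w"
    using w by (meson continuous_on_eq_continuous_within has_vector_derivative_continuous)
  have "bounded (w' ` {0..s})"
    using w' by (intro compact_imp_bounded compact_continuous_image) auto
  then obtain M where M: "\<And>\<tau>. \<tau> \<in> {0..s} \<Longrightarrow> \<bar>w' \<tau>\<bar> \<le> M"
    unfolding bounded_iff by (metis imageI real_norm_def)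
  \<comment> \<open>The Lipschitz bound makes \<open>h\<close> of order
    \<open>(s - \<tau>)\<^sup>2\<close>, which beats the singular kernel: \<open>\<Phi>\<close> is
    of order \<open>(s - \<tau>) powr (2 - a)\<close> and so tends to its value 0 at
    \<open>s\<close>.\<close>
  have lip: "\<bar>w s - w \<tau>\<bar> \<le> M * (s - \<tau>)" if "\<tau> \<in> {0..s}" for \<tau>
    using field_differentiable_bound[of "{0..s}" w w' M s \<tau>] w M that s
    unfolding has_real_derivative_iff_has_vector_derivative by simp
  have h_le: "\<bar>\<Phi> \<tau>\<bar> \<le> M\<^sup>2 / 2 * (s - \<tau>) powr (2 - a)" if "\<tau> \<in> {0..s}" for \<tau>
  proof -
    have "(w s - w \<tau>)\<^sup>2 \<le> (M * (s - \<tau>))\<^sup>2"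
      using lip[OF that] by (metis abs_ge_zero power2_abs power_mono)
    then have "\<bar>\<Phi> \<tau>\<bar> \<le> (M * (s - \<tau>))\<^sup>2 / 2 * (s - \<tau>) powr - a"
      unfolding \<Phi>_def h_def by (auto simp: abs_mult intro!: mult_right_mono)
    also have "\<dots> = M\<^sup>2 / 2 * (s - \<tau>) powr (2 - a)"
      using powr_add[of "s - \<tau>" 2 "- a"] that by (simp add: power_mult_distrib)
    finally show ?thesis .
  qed
  have [simp]: "\<Phi> s = 0" by (simp add: \<Phi>_def)
  have "continuous_on {0..s} \<Phi>"
    unfolding continuous_on_eq_continuous_within
  proof
    fix \<tau> assume \<tau>: "\<tau> \<in> {0..s}"
    show "continuous (at \<tau> within {0..s}) \<Phi>"
    proof (cases "\<tau> = s")
      case True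
      have "continuous_on {0..s} (\<lambda>\<tau>. M\<^sup>2 / 2 * (s - \<tau>) powr (2 - a))"
        using a by (intro continuous_intros continuous_on_powr') auto
      then have "((\<lambda>\<tau>. M\<^sup>2 / 2 * (s - \<tau>) powr (2 - a)) \<longlongrightarrow> 0) (at s within {0..s})"
        using \<tau> True by (force simp: continuous_on_def)
      then have "(\<Phi> \<longlongrightarrow> 0) (at s within {0..s})"
        by (rule Lim_null_comparison[rotated]) (use h_le in \<open>auto simp: eventually_at_filter intro!: always_eventually\<close>)
      then show ?thesis using True by (simp add: continuous_within)
    next
      case False
      have "isCont (\<lambda>\<tau>. (s - \<tau>) powr - a) \<tau>"
        using False by (intro continuous_intros) auto
      then have "continuous (at \<tau> within {0..s}) (\<lambda>\<tau>. (s - \<tau>) powr - a)"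
        by (rule continuous_at_imp_continuous_at_within)
      moreover have "continuous (at \<tau> within {0..s}) w"
        using cw \<tau> by (simp add: continuous_on_eq_continuous_within)
      then have "continuous (at \<tau> within {0..s}) h"
        unfolding h_def by (intro continuous_intros) auto
      ultimately show ?thesis
        unfolding \<Phi>_def by (intro continuous_mult continuous_minus)
    qed
  qed
  then have "(\<Phi>' has_integral (\<Phi> s - \<Phi> 0)) {0..s}"
  proof (rule fundamental_theorem_of_calculus_interior[rotated])
    show "(\<Phi> has_vector_derivative \<Phi>' x) (at x)" if "x \<in> {0<..<s}" for x
    proof -
      have "(w has_real_derivative w' x) (at x)"
        using that by (intro has_real_derivative_interior[OF w]) auto
      then have "(h has_real_derivative - (w' x * (w s - w x))) (at x)"
        unfolding h_def by (auto intro!: derivative_eq_intros)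
      from DERIV_mult[OF DERIV_minus[OF this] kernel_has_real_derivative, of s "- a"]
      show ?thesis
        unfolding has_real_derivative_iff_has_vector_derivative[symmetric] \<Phi>_def \<Phi>'_def
        using that by (simp add: algebra_simps)
    qed
  qed (use s in auto)
  moreover have "(\<lambda>\<tau>. (w s * w' \<tau> - w \<tau> * w' \<tau>) * (s - \<tau>) powr - a) absolutely_integrable_on {0..s}"
    using a s by (intro absolutely_integrable_kernel_mult continuous_intros cw w') auto
  then have "(\<lambda>\<tau>. (w s * w' \<tau> - w \<tau> * w' \<tau>) * (s - \<tau>) powr - a) integrable_on {0..s}"
    by (rule set_lebesgue_integral_eq_integral)
  then have "((\<lambda>\<tau>. (w s * w' \<tau> - w \<tau> * w' \<tau>) * (s - \<tau>) powr - a) has_integral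
      integral {0..s} (\<lambda>\<tau>. (w s * w' \<tau> - w \<tau> * w' \<tau>) * (s - \<tau>) powr - a)) {0..s}"
    by (rule integrable_integral)
  ultimately have "\<Phi> s - \<Phi> 0 \<le> integral {0..s} (\<lambda>\<tau>. (w s * w' \<tau> - w \<tau> * w' \<tau>) * (s - \<tau>) powr - a)"
    by (rule has_integral_le) (use a in \<open>auto simp: \<Phi>'_def h_def algebra_simps\<close>)
  moreover have "\<Phi> 0 \<le> 0"
    by (simp add: \<Phi>_def h_def)
  moreover have "integral {0..s} (\<lambda>\<tau>. (w s * w' \<tau> - w \<tau> * w' \<tau>) * (s - \<tau>) powr - a)
     = integral {0..s} (\<lambda>\<tau>. w s * (w' \<tau> * (s - \<tau>) powr - a)) - integral {0..s} (\<lambda>\<tau>. w \<tau> * w' \<tau> * (s - \<tau>) powr - a)"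
    unfolding left_diff_distrib mult.assoc[of "w s"]
    by (intro integral_diff set_lebesgue_integral_eq_integral(1) set_integrable_mult_right
        absolutely_integrable_kernel_mult continuous_intros a s cw w')
  ultimately show ?thesis by simp
qed

section \<open>Iterated kernel integrals by Fubini's theorem\<close>

lemma has_integral_kernel_left:
  fixes a \<tau> t :: real
  assumes "a < 1" "\<tau> \<le> t"
  shows "((\<lambda>s. (s - \<tau>) powr - a) has_integral (t - \<tau>) powr (1 - a) / (1 - a)) {\<tau>..t}"
proof -
  have "((\<lambda>s. (s - \<tau>) powr - a) has_integral
      (t - \<tau>) powr (1 - a) / (1 - a) - (\<tau> - \<tau>) powr (1 - a) / (1 - a)) {\<tau>..t}"
  proof (rule fundamental_theorem_of_calculus_interior)
    show "continuous_on {\<tau>..t} (\<lambda>s. (s - \<tau>) powr (1 - a) / (1 - a))"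
      using assms by (intro continuous_intros continuous_on_powr') auto
    show "((\<lambda>s. (s - \<tau>) powr (1 - a) / (1 - a)) has_vector_derivative (x - \<tau>) powr - a) (at x)"
      if "x \<in> {\<tau><..<t}" for x
    proof -
      have "((\<lambda>z. z powr (1 - a)) has_real_derivative (1 - a) * (x - \<tau>) powr (1 - a - 1)) (at (x - \<tau>))"
        using that by (intro has_real_derivative_powr) auto
      moreover have "((\<lambda>s. s - \<tau>) has_real_derivative 1) (at x)"
        by (auto intro!: derivative_eq_intros)
      ultimately have "((\<lambda>s. (s - \<tau>) powr (1 - a)) has_real_derivative (1 - a) * (x - \<tau>) powr - a) (at x)"
        using DERIV_chain2 by fastforce
      from DERIV_cdivide[OF this, of "1 - a"] show ?thesis
        using assms unfolding has_real_derivative_iff_has_vector_derivative[symmetric] by simp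
    qed
  qed (use assms in auto)
  then show ?thesis by simp
qed

text \<open>Fubini's theorem is applied over \<open>lborel\<close>, while absolute integrability
  refers to its completion. Borel measurability of the integrand allows the passage.\<close>

lemma set_integrable_lborel_kernel_mult:
  fixes a s :: real
  assumes "a < 1" "0 \<le> s" "continuous_on {0..s} \<phi>"
  shows "set_integrable lborel {0..s} (\<lambda>\<tau>. \<phi> \<tau> * (s - \<tau>) powr - a)"
proof -
  have "(\<lambda>\<tau>. (indicator {0..s} \<tau> *\<^sub>R \<phi> \<tau>) * (s - \<tau>) powr - a) \<in> borel_measurable borel"
    using borel_measurable_continuous_on_indicator[OF _ assms(3)] by measurable
  then have "(\<lambda>\<tau>. indicator {0..s} \<tau> *\<^sub>R (\<phi> \<tau> * (s - \<tau>) powr - a)) \<in> borel_measurable lborel"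
    by (simp add: mult.assoc)
  with absolutely_integrable_kernel_mult[OF assms] show ?thesis
    unfolding set_integrable_def by (simp add: integrable_completion)
qed

lemma set_integrable_lborel_kernel_left:
  fixes a \<tau> t :: real
  assumes "a < 1" "\<tau> \<le> t"
  shows "set_integrable lborel {\<tau>..t} (\<lambda>s. (s - \<tau>) powr - a)"
proof -
  have "(\<lambda>s. (s - \<tau>) powr - a) absolutely_integrable_on {\<tau>..t}"
    using has_integral_kernel_left[OF assms] by (intro nonnegative_absolutely_integrable_1) auto
  then show ?thesis
    unfolding set_integrable_def by (subst (asm) integrable_completion) auto
qed

text \<open>This is the semigroup law for fractional integrals of orders 1 and \<open>1 - a\<close>,
  up to Gamma factors. Exchange the integrals over the triangle 0 \<le> \<tau> \<le> s \<le> t; the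
  inner integral of \<open>(s - \<tau>) powr - a\<close> over \<open>s\<close> from
  \<open>\<tau>\<close> to \<open>t\<close> is explicit.\<close>

lemma has_integral_iterated_kernel:
  fixes a t :: real
  assumes a: "a < 1" and t: "0 \<le> t" and \<phi>: "continuous_on {0..t} \<phi>"
  shows "((\<lambda>s. integral {0..s} (\<lambda>\<tau>. \<phi> \<tau> * (s - \<tau>) powr - a)) has_integral
     integral {0..t} (\<lambda>\<tau>. (t - \<tau>) powr (1 - a) / (1 - a) * \<phi> \<tau>)) {0..t}"
proof -
  define \<psi> where "\<psi> \<tau> = indicator {0..t} \<tau> *\<^sub>R \<phi> \<tau>" for \<tau>
  have [measurable]: "\<psi> \<in> borel_measurable borel"
    unfolding \<psi>_def using \<phi> by (intro borel_measurable_continuous_on_indicator) auto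
  \<comment> \<open>The integrand is extended by zero outside the triangle. The two facts below
    display it as a function of \<open>s\<close> with \<open>\<tau>\<close> fixed and of
    \<open>\<tau>\<close> with \<open>s\<close> fixed.\<close>
  define g where "g \<tau> s = (if \<tau> \<le> s \<and> s \<le> t then \<psi> \<tau> * (s - \<tau>) powr - a else 0)" for \<tau> s
  have g_s: "g \<tau> s = \<psi> \<tau> * (indicator {\<tau>..t} s *\<^sub>R (s - \<tau>) powr - a)" for \<tau> s
    by (simp add: g_def)
  have g_\<tau>: "g \<tau> s = indicator {0..t} s *\<^sub>R (indicator {0..s} \<tau> *\<^sub>R (\<phi> \<tau> * (s - \<tau>) powr - a))" for \<tau> s
    by (auto simp: g_def \<psi>_def indicator_def)
  have int_s: "integrable lborel (g \<tau>)" for \<tau>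
    using set_integrable_lborel_kernel_left[OF a, of \<tau> t] unfolding g_s set_integrable_def
    by (cases "\<tau> \<le> t") (auto simp: \<psi>_def)
  have eq_s: "(LINT s|lborel. indicator {\<tau>..t} s *\<^sub>R (s - \<tau>) powr - a) = (t - \<tau>) powr (1 - a) / (1 - a)"
    if "\<tau> \<le> t" for \<tau>
    using set_borel_integral_eq_integral(2)[OF set_integrable_lborel_kernel_left[OF a that]]
      integral_unique[OF has_integral_kernel_left[OF a that]]
    by (simp add: set_lebesgue_integral_def)
  have eq_g: "(LINT s|lborel. g \<tau> s) = indicator {0..t} \<tau> *\<^sub>R ((t - \<tau>) powr (1 - a) / (1 - a) * \<phi> \<tau>)" for \<tau>
    unfolding g_s integral_mult_right_zero
    by (cases "\<tau> \<in> {0..t}") (auto simp: eq_s[unfolded real_scaleR_def] \<psi>_def)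
  have eq_norm_g: "(LINT s|lborel. norm (g \<tau> s)) = indicator {0..t} \<tau> *\<^sub>R ((t - \<tau>) powr (1 - a) / (1 - a) * \<bar>\<phi> \<tau>\<bar>)" for \<tau>
  proof -
    have "(LINT s|lborel. norm (g \<tau> s)) = (LINT s|lborel. \<bar>\<psi> \<tau>\<bar> * (indicator {\<tau>..t} s *\<^sub>R (s - \<tau>) powr - a))"
      by (intro Bochner_Integration.integral_cong) (auto simp: g_s abs_mult)
    then show ?thesis
      unfolding integral_mult_right_zero
      by (cases "\<tau> \<in> {0..t}") (auto simp: eq_s[unfolded real_scaleR_def] \<psi>_def)
  qed
  \<comment> \<open>Tonelli's criterion: the integral of the norm over \<open>s\<close> is a
    continuous function of \<open>\<tau>\<close> on the compact interval and zero elsewhere.\<close>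
  have intg: "integrable (lborel \<Otimes>\<^sub>M lborel) (\<lambda>(\<tau>, s). g \<tau> s)"
  proof (rule lborel_pair.Fubini_integrable)
    show "(\<lambda>(\<tau>, s). g \<tau> s) \<in> borel_measurable (lborel \<Otimes>\<^sub>M lborel)"
      unfolding g_def by measurable
    have "set_integrable lborel {0..t} (\<lambda>\<tau>. (t - \<tau>) powr (1 - a) / (1 - a) * \<bar>\<phi> \<tau>\<bar>)"
      using a by (intro borel_integrable_atLeastAtMost' continuous_intros continuous_on_powr' \<phi>) auto
    then show "integrable lborel (\<lambda>\<tau>. LINT s|lborel. norm (case (\<tau>, s) of (\<tau>, s) \<Rightarrow> g \<tau> s))"
      by (simp only: prod.case eq_norm_g set_integrable_def)
  qed (use int_s in auto)
  have eq_\<tau>: "(LINT \<tau>|lborel. g \<tau> s) = indicator {0..t} s *\<^sub>R integral {0..s} (\<lambda>\<tau>. \<phi> \<tau> * (s - \<tau>) powr - a)" for s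
  proof (cases "s \<in> {0..t}")
    case True
    then have "continuous_on {0..s} \<phi>"
      using \<phi> by (rule_tac continuous_on_subset) auto
    then have "set_integrable lborel {0..s} (\<lambda>\<tau>. \<phi> \<tau> * (s - \<tau>) powr - a)"
      using True by (intro set_integrable_lborel_kernel_mult a) auto
    from set_borel_integral_eq_integral(2)[OF this] show ?thesis
      by (simp add: g_\<tau> set_lebesgue_integral_def)
  qed (simp add: g_\<tau>)
  have int_iter: "set_integrable lborel {0..t} (\<lambda>s. integral {0..s} (\<lambda>\<tau>. \<phi> \<tau> * (s - \<tau>) powr - a))"
    using lborel_pair.integrable_snd[OF intg] by (simp add: eq_\<tau> set_integrable_def)
  have int_ker: "set_integrable lborel {0..t} (\<lambda>\<tau>. (t - \<tau>) powr (1 - a) / (1 - a) * \<phi> \<tau>)"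
    using a by (intro borel_integrable_atLeastAtMost' continuous_intros continuous_on_powr' \<phi>) auto
  have "integral {0..t} (\<lambda>s. integral {0..s} (\<lambda>\<tau>. \<phi> \<tau> * (s - \<tau>) powr - a)) = (LINT s|lborel. LINT \<tau>|lborel. g \<tau> s)"
    using set_borel_integral_eq_integral(2)[OF int_iter] by (simp add: eq_\<tau> set_lebesgue_integral_def)
  also have "\<dots> = (LINT \<tau>|lborel. LINT s|lborel. g \<tau> s)"
    by (rule lborel_pair.Fubini_integral[OF intg])
  also have "\<dots> = integral {0..t} (\<lambda>\<tau>. (t - \<tau>) powr (1 - a) / (1 - a) * \<phi> \<tau>)"
    using set_borel_integral_eq_integral(2)[OF int_ker] by (simp add: eq_g set_lebesgue_integral_def)
  finally show ?thesis
    using set_borel_integral_eq_integral(1)[OF int_iter] by (simp add: has_integral_iff)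
qed

section \<open>Energy inequality in time for a fixed point x\<close>

lemma Gamma_two_minus:
  fixes a :: real
  assumes "a < 1"
  shows "Gamma (2 - a) = (1 - a) * Gamma (1 - a)"
proof -
  have "1 - a \<notin> \<int>\<^sub>\<le>\<^sub>0"
    using assms by (auto dest: nonpos_Ints_nonpos)
  from Gamma_plus1[OF this] show ?thesis
    by (simp add: add.commute[of _ 1])
qed

lemma continuous_on_section:
  assumes "continuous_on (A \<times> B) (\<lambda>(x, s). g x s)"
  shows "x \<in> A \<Longrightarrow> continuous_on B (g x)" "s \<in> B \<Longrightarrow> continuous_on A (\<lambda>x. g x s)"
proof -
  show "continuous_on B (g x)" if "x \<in> A"
    using continuous_on_compose2[OF assms continuous_on_Pair[OF continuous_on_const continuous_on_id], where s = B]
      that by auto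
  show "continuous_on A (\<lambda>x. g x s)" if "s \<in> B"
    using continuous_on_compose2[OF assms continuous_on_Pair[OF continuous_on_id continuous_on_const], where s = A]
      that by auto
qed

text \<open>Alikhanov's inequality at each \<open>s\<close>, integrated over \<open>s\<close>. The
  function \<open>c\<close> stands for the right-hand side of the equation: it agrees with the
  Caputo derivative only for positive \<open>s\<close>, as the equation does.\<close>

lemma caputo_energy_ge:
  fixes a t :: real
  assumes a: "0 < a" "a < 1" and t: "0 \<le> t"
    and w: "\<And>s. s \<in> {0..t} \<Longrightarrow> (w has_vector_derivative w' s) (at s within {0..t})"
    and w': "continuous_on {0..t} w'"
    and c: "\<And>s. s \<in> {0<..t} \<Longrightarrow> c s = 1 / Gamma (1 - a) * integral {0..s} (\<lambda>\<tau>. w' \<tau> * (s - \<tau>) powr - a)"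
    and int: "(\<lambda>s. w s * c s) integrable_on {0..t}"
  shows "1 / Gamma (1 - a) * integral {0..t} (\<lambda>s. (t - s) powr - a * (w s)\<^sup>2)
    \<le> t powr (1 - a) / Gamma (2 - a) * (w 0)\<^sup>2 + 2 * integral {0..t} (\<lambda>s. w s * c s)"
proof -
  have \<Gamma>: "Gamma (1 - a) > 0"
    using a by (intro Gamma_real_pos) auto
  note \<Gamma>2 = Gamma_two_minus[OF a(2)]
  have cw: "continuous_on {0..t} w"
    using w by (meson continuous_on_eq_continuous_within has_vector_derivative_continuous)
  let ?J = "\<lambda>s. integral {0..s} (\<lambda>\<tau>. w \<tau> * w' \<tau> * (s - \<tau>) powr - a)"
  have J: "(?J has_integral integral {0..t} (\<lambda>\<tau>. (t - \<tau>) powr (1 - a) / (1 - a) * (w \<tau> * w' \<tau>))) {0..t}"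
    using a t by (intro has_integral_iterated_kernel continuous_intros cw w') auto
  have le: "1 / Gamma (1 - a) * ?J s \<le> w s * c s" if "s \<in> {0<..t}" for s
  proof -
    have "?J s \<le> w s * integral {0..s} (\<lambda>\<tau>. w' \<tau> * (s - \<tau>) powr - a)"
    proof (rule kernel_Alikhanov)
      show "(w has_vector_derivative w' \<tau>) (at \<tau> within {0..s})" if "\<tau> \<in> {0..s}" for \<tau>
        using that \<open>s \<in> {0<..t}\<close> by (intro has_vector_derivative_within_subset[OF w]) auto
      show "continuous_on {0..s} w'"
        using that by (intro continuous_on_subset[OF w']) auto
    qed (use a that in auto)
    then show ?thesis
      using \<Gamma> mult_left_mono[of _ _ "1 / Gamma (1 - a)"] unfolding c[OF that]
      by (simp add: mult.left_commute)
  qed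
  have int_J: "(\<lambda>s. 1 / Gamma (1 - a) * ?J s) integrable_on {0..t}"
    using has_integral_mult_right[OF J] by blast
  have "1 / Gamma (1 - a) * integral {0..t} ?J = integral {0..t} (\<lambda>s. 1 / Gamma (1 - a) * ?J s)"
    by simp
  \<comment> \<open>The endpoint 0 is removed because \<open>c\<close> is tied to the Caputo
    derivative only for \<open>s > 0\<close>.\<close>
  also have "\<dots> = integral {0<..<t} (\<lambda>s. 1 / Gamma (1 - a) * ?J s)"
    by (simp add: integral_open_interval_real)
  also have "\<dots> \<le> integral {0<..<t} (\<lambda>s. w s * c s)"
    using int_J int le
    by (intro integral_le) (auto simp: integrable_on_open_interval_real)
  also have "\<dots> = integral {0..t} (\<lambda>s. w s * c s)"
    by (simp add: integral_open_interval_real)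
  finally have J_le: "1 / Gamma (1 - a) * integral {0..t} ?J \<le> integral {0..t} (\<lambda>s. w s * c s)" .
  \<comment> \<open>Integration by parts with the derivative \<open>2 * (w s * w' s)\<close> of the
    square yields the same weight \<open>(t - s) powr (1 - a) / (1 - a)\<close> as the iterated
    integral of \<open>?J\<close>. This links the fractional integral of the square to Alikhanov's
    inequality.\<close>
  have "integral {0..t} (\<lambda>s. (t - s) powr - a * (w s)\<^sup>2) =
     t powr (1 - a) / (1 - a) * (w 0)\<^sup>2 +
     integral {0..t} (\<lambda>s. (t - s) powr (1 - a) / (1 - a) * (2 * (w s * w' s)))"
  proof (rule kernel_by_parts)
    show "((\<lambda>s. (w s)\<^sup>2) has_vector_derivative 2 * (w s * w' s)) (at s within {0..t})"
      if "s \<in> {0..t}" for s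
      using has_vector_derivative_mult[OF w[OF that] w[OF that]]
      by (simp add: power2_eq_square mult.commute)
  qed (use a t in \<open>auto intro!: continuous_intros cw w'\<close>)
  also have "integral {0..t} (\<lambda>s. (t - s) powr (1 - a) / (1 - a) * (2 * (w s * w' s))) = 2 * integral {0..t} ?J"
    using J by (simp add: integral_unique mult.left_commute[of _ 2])
  finally have "1 / Gamma (1 - a) * integral {0..t} (\<lambda>s. (t - s) powr - a * (w s)\<^sup>2) =
     t powr (1 - a) / Gamma (2 - a) * (w 0)\<^sup>2 + 2 * (1 / Gamma (1 - a) * integral {0..t} ?J)"
    unfolding \<Gamma>2 by (simp add: algebra_simps)
  then show ?thesis using J_le by simp
qed

section \<open>Integrability in x of the fractional terms\<close>

lemma powr_le_one_plus:
  fixes x r :: real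
  assumes "0 \<le> x" "0 \<le> r" "r \<le> 1"
  shows "x powr r \<le> 1 + x"
proof (cases "x \<le> 1")
  case True
  then have "x powr r \<le> 1" using assms by (intro powr_le1) auto
  then show ?thesis using assms by linarith
next
  case False
  then have "x powr r \<le> x powr 1" using assms by (intro powr_mono) auto
  then show ?thesis using assms by simp
qed

text \<open>The order \<alpha> may oscillate or approach 0 or 1 at the ends of the interval, so the
  integrands need not extend continuously to it. Boundedness and measurability suffice, and the
  endpoints form a null set.\<close>

lemma integrable_on_bounded_continuous_open_interval:
  fixes f :: "real \<Rightarrow> real"
  assumes "continuous_on {a<..<b} f" "\<And>x. x \<in> {a<..<b} \<Longrightarrow> \<bar>f x\<bar> \<le> C"
  shows "f integrable_on {a..b}"
proof -
  have "f integrable_on {a<..<b}"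
  proof (rule measurable_bounded_by_integrable_imp_integrable_real)
    show "f \<in> borel_measurable (lebesgue_on {a<..<b})"
      using assms by (intro continuous_imp_measurable_on_sets_lebesgue) auto
    show "(\<lambda>x. C) integrable_on {a<..<b}"
      unfolding integrable_on_open_interval_real by (rule integrable_const_ivl)
  qed (use assms in auto)
  then show ?thesis by (simp add: integrable_on_open_interval_real)
qed

text \<open>The reciprocal Gamma function is entire, so compactness bounds it uniformly over all
  orders in [0, 1]. Both fractional terms are brought to this form, with a bounded continuous
  \<open>g\<close>.\<close>

lemma integrable_rGamma_mult:
  fixes l :: real and \<alpha> g :: "real \<Rightarrow> real"
  assumes \<alpha>: "continuous_on {0<..<l} \<alpha>" "\<And>x. x \<in> {0<..<l} \<Longrightarrow> \<alpha> x \<in> {0<..<1}"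
    and g: "continuous_on {0<..<l} g" "\<And>x. x \<in> {0<..<l} \<Longrightarrow> \<bar>g x\<bar> \<le> C"
  shows "(\<lambda>x. 1 / Gamma (2 - \<alpha> x) * g x) integrable_on {0..l}"
proof -
  have "bounded ((\<lambda>y. rGamma (2 - y)) ` {0..1::real})"
    by (intro compact_imp_bounded compact_continuous_image continuous_on_compose2[OF continuous_on_rGamma]
        continuous_intros) auto
  then obtain B where B: "\<And>y::real. y \<in> {0..1} \<Longrightarrow> \<bar>rGamma (2 - y)\<bar> \<le> B"
    unfolding bounded_iff by (metis imageI real_norm_def)
  have "(\<lambda>x. rGamma (2 - \<alpha> x) * g x) integrable_on {0..l}"
  proof (rule integrable_on_bounded_continuous_open_interval)
    show "continuous_on {0<..<l} (\<lambda>x. rGamma (2 - \<alpha> x) * g x)"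
      by (intro continuous_on_mult continuous_on_compose2[OF continuous_on_rGamma[of UNIV]]
          continuous_intros \<alpha> g) auto
    show "\<bar>rGamma (2 - \<alpha> x) * g x\<bar> \<le> B * C" if "x \<in> {0<..<l}" for x
    proof -
      have "\<bar>rGamma (2 - \<alpha> x)\<bar> \<le> B" using \<alpha>(2)[OF that] by (intro B) auto
      then show ?thesis
        using g(2)[OF that] by (simp add: abs_mult mult_mono')
    qed
  qed
  then show ?thesis by (simp add: rGamma_inverse_Gamma divide_inverse)
qed

lemma integrable_powr_div_Gamma:
  fixes l t :: real
  assumes \<alpha>: "continuous_on {0<..<l} \<alpha>" "\<And>x. x \<in> {0<..<l} \<Longrightarrow> \<alpha> x \<in> {0<..<1}"
    and t: "0 < t" and g: "continuous_on {0..l} g"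
  shows "(\<lambda>x. t powr (1 - \<alpha> x) / Gamma (2 - \<alpha> x) * g x) integrable_on {0..l}"
proof -
  have "bounded (g ` {0..l})"
    using g by (intro compact_imp_bounded compact_continuous_image) auto
  then obtain B where B: "\<And>x. x \<in> {0..l} \<Longrightarrow> \<bar>g x\<bar> \<le> B"
    unfolding bounded_iff by (metis imageI real_norm_def)
  have "(\<lambda>x. 1 / Gamma (2 - \<alpha> x) * (t powr (1 - \<alpha> x) * g x)) integrable_on {0..l}"
  proof (rule integrable_rGamma_mult[OF \<alpha>])
    show "continuous_on {0<..<l} (\<lambda>x. t powr (1 - \<alpha> x) * g x)"
      using t by (intro continuous_intros \<alpha> continuous_on_subset[OF g]) auto
    show "\<bar>t powr (1 - \<alpha> x) * g x\<bar> \<le> (1 + t) * B" if "x \<in> {0<..<l}" for x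
    proof -
      have "t powr (1 - \<alpha> x) \<le> 1 + t"
        using t \<alpha>(2)[OF that] by (intro powr_le_one_plus) auto
      then show ?thesis
        using B[of x] that by (auto simp: abs_mult intro!: mult_mono')
    qed
  qed
  then show ?thesis by simp
qed

text \<open>After integration by parts the kernel becomes
  \<open>(t - s) powr (1 - \<alpha> x)\<close>, which is bounded uniformly in \<open>x\<close> by
  \<open>1 + t\<close>. The factor \<open>1 / (1 - \<alpha> x)\<close>, unbounded when \<alpha>
  tends to 1, joins \<open>1 / Gamma (1 - \<alpha> x)\<close> to form the bounded
  \<open>1 / Gamma (2 - \<alpha> x)\<close>.\<close>

lemma RL_integral_integrable:
  fixes l t :: real
  assumes \<alpha>: "continuous_on {0<..<l} \<alpha>" "\<And>x. x \<in> {0<..<l} \<Longrightarrow> \<alpha> x \<in> {0<..<1}"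
    and t: "0 < t"
    and v: "\<And>x s. x \<in> {0..l} \<Longrightarrow> s \<in> {0..t} \<Longrightarrow> (v x has_vector_derivative v' x s) (at s within {0..t})"
    and v': "continuous_on ({0..l} \<times> {0..t}) (\<lambda>(x, s). v' x s)"
    and v0: "continuous_on {0..l} (\<lambda>x. v x 0)"
  shows "(\<lambda>x. RL_integral (\<lambda>x. 1 - \<alpha> x) v x t) integrable_on {0..l}"
proof -
  have "bounded ((\<lambda>(x, s). v' x s) ` ({0..l} \<times> {0..t}))"
    using v' by (intro compact_imp_bounded compact_continuous_image compact_Times) auto
  then obtain B where "\<And>p. p \<in> {0..l} \<times> {0..t} \<Longrightarrow> \<bar>case p of (x, s) \<Rightarrow> v' x s\<bar> \<le> B"
    unfolding bounded_iff by (metis imageI real_norm_def)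
  then have B: "\<bar>v' x s\<bar> \<le> B" if "x \<in> {0..l}" "s \<in> {0..t}" for x s
    using that by fastforce
  define I where "I x = integral {0..t} (\<lambda>s. (t - s) powr (1 - \<alpha> x) * v' x s)" for x
  have "(\<lambda>x. 1 / Gamma (2 - \<alpha> x) * I x) integrable_on {0..l}"
  proof (rule integrable_rGamma_mult[OF \<alpha>])
    \<comment> \<open>The exponent is positive on the open interval, so joint continuity holds up to
      \<open>s = t\<close> and passes to the parametric integral.\<close>
    have "continuous_on ({0<..<l} \<times> {0..t}) (\<lambda>p. (t - snd p) powr (1 - \<alpha> (fst p)) * (case p of (x, s) \<Rightarrow> v' x s))"
    proof (intro continuous_on_mult continuous_on_powr' continuous_on_diff continuous_on_const
        continuous_on_snd continuous_on_id continuous_on_subset[OF v'])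
      show "continuous_on ({0<..<l} \<times> {0..t}) (\<lambda>p. \<alpha> (fst p))"
        by (intro continuous_on_compose2[OF \<alpha>(1)] continuous_intros) auto
    qed (use \<alpha>(2) in \<open>auto simp: less_imp_le\<close>)
    then show "continuous_on {0<..<l} I"
      unfolding I_def using integral_continuous_on_param[of "{0<..<l}" 0 t
          "\<lambda>x s. (t - s) powr (1 - \<alpha> x) * v' x s"]
      by (simp add: case_prod_unfold)
    show "\<bar>I x\<bar> \<le> (1 + t) * B * t" if "x \<in> {0<..<l}" for x
    proof -
      have "\<bar>(t - s) powr (1 - \<alpha> x) * v' x s\<bar> \<le> (1 + t) * B" if "s \<in> {0..t}" for s
      proof -
        have "(t - s) powr (1 - \<alpha> x) \<le> 1 + (t - s)"
          using that \<alpha>(2)[OF \<open>x \<in> {0<..<l}\<close>] by (intro powr_le_one_plus) auto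
        then show ?thesis
          using B[of x s] that \<open>x \<in> {0<..<l}\<close> by (auto simp: abs_mult intro!: mult_mono')
      qed
      moreover have "(\<lambda>s. (t - s) powr (1 - \<alpha> x) * v' x s) integrable_on {0..t}"
      proof (intro integrable_continuous_real continuous_on_mult continuous_on_powr')
        show "continuous_on {0..t} (v' x)"
          by (rule continuous_on_section(1)[OF v']) (use that in auto)
      qed (use \<alpha>(2)[OF that] in \<open>auto intro!: continuous_intros\<close>)
      ultimately show ?thesis
        using t integral_norm_bound_integral[of "\<lambda>s. (t - s) powr (1 - \<alpha> x) * v' x s" "{0..t}" "\<lambda>_. (1 + t) * B"]
          integrable_const_ivl[of "(1 + t) * B" 0 t]
        by (simp add: I_def mult_ac)
    qed
  qed
  moreover have "(\<lambda>x. t powr (1 - \<alpha> x) / Gamma (2 - \<alpha> x) * v x 0) integrable_on {0..l}"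
    by (rule integrable_powr_div_Gamma[OF \<alpha> t v0])
  ultimately have "(\<lambda>x. t powr (1 - \<alpha> x) / Gamma (2 - \<alpha> x) * v x 0 + 1 / Gamma (2 - \<alpha> x) * I x) integrable_on {0<..<l}"
    unfolding integrable_on_open_interval_real by (rule integrable_add[rotated])
  moreover have "RL_integral (\<lambda>x. 1 - \<alpha> x) v x t = t powr (1 - \<alpha> x) / Gamma (2 - \<alpha> x) * v x 0 + 1 / Gamma (2 - \<alpha> x) * I x"
    if "x \<in> {0<..<l}" for x
  proof -
    have a: "0 < \<alpha> x" "\<alpha> x < 1" using \<alpha>(2)[OF that] by auto
    note \<Gamma>2 = Gamma_two_minus[OF a(2)]
    have "continuous_on {0..t} (v' x)"
      by (rule continuous_on_section(1)[OF v']) (use that in auto)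
    then have "integral {0..t} (\<lambda>s. (t - s) powr - \<alpha> x * v x s) =
      t powr (1 - \<alpha> x) / (1 - \<alpha> x) * v x 0 + integral {0..t} (\<lambda>s. (t - s) powr (1 - \<alpha> x) / (1 - \<alpha> x) * v' x s)"
      using a t that v by (intro kernel_by_parts) auto
    moreover have "integral {0..t} (\<lambda>s. (t - s) powr (1 - \<alpha> x) / (1 - \<alpha> x) * v' x s) = I x / (1 - \<alpha> x)"
      unfolding I_def by (simp flip: integral_divide)
    ultimately show ?thesis
      unfolding RL_integral_def \<Gamma>2 by (auto simp: add_divide_distrib distrib_left mult_ac)
  qed
  ultimately show ?thesis
    unfolding integrable_on_open_interval_real[symmetric] by (rule integrable_eq[OF _ sym])
qed

section \<open>Energy estimate in space at a fixed time\<close>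

lemma square_increment_le:
  fixes w w' :: "real \<Rightarrow> real"
  assumes "a \<le> b" and w: "\<And>x. x \<in> {a..b} \<Longrightarrow> (w has_vector_derivative w' x) (at x within {a..b})"
    and w': "continuous_on {a..b} w'"
  shows "(w b - w a)\<^sup>2 \<le> (b - a) * integral {a..b} (\<lambda>x. (w' x)\<^sup>2)"
proof (cases "a = b")
  case False
  with \<open>a \<le> b\<close> have ab: "a < b" by simp
  \<comment> \<open>This is the mean of \<open>w'\<close>. Expanding the nonnegative integral of the
    square of \<open>w' x - m\<close> gives the Cauchy-Schwarz bound.\<close>
  define m where "m = (w b - w a) / (b - a)"
  have "(w' has_integral (w b - w a)) {a..b}"
    using assms by (intro fundamental_theorem_of_calculus) auto
  then have "((\<lambda>x. (w' x)\<^sup>2 - 2 * m * w' x + m\<^sup>2) has_integral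
      integral {a..b} (\<lambda>x. (w' x)\<^sup>2) - 2 * m * (w b - w a) + (b - a) *\<^sub>R m\<^sup>2) {a..b}"
    using ab
    by (intro has_integral_add has_integral_diff has_integral_mult_right has_integral_const_real[THEN has_integral_eq_rhs]
        integrable_integral integrable_continuous_real continuous_intros w') auto
  then have "0 \<le> integral {a..b} (\<lambda>x. (w' x)\<^sup>2) - 2 * m * (w b - w a) + (b - a) *\<^sub>R m\<^sup>2"
  proof (rule has_integral_nonneg)
    show "0 \<le> (w' x)\<^sup>2 - 2 * m * w' x + m\<^sup>2" for x
      using zero_le_power2[of "w' x - m"] by (simp add: power2_diff algebra_simps)
  qed
  moreover have "w b - w a = m * (b - a)"
    using ab by (simp add: m_def)
  ultimately have "(b - a) * (m\<^sup>2 * (b - a)) \<le> (b - a) * integral {a..b} (\<lambda>x. (w' x)\<^sup>2)"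
    using ab by (intro mult_left_mono) (auto simp: power2_eq_square algebra_simps)
  then show ?thesis
    unfolding \<open>w b - w a = _\<close> by (simp add: power2_eq_square algebra_simps)
qed simp

text \<open>Averaging the estimates from both ends gives constant 1 at the endpoints. The increments
  from the left and to the right use complementary intervals, so the energy of \<open>w'\<close> is
  counted once, with factor \<open>l\<close>.\<close>

lemma square_le_endpoints:
  fixes w w' :: "real \<Rightarrow> real"
  assumes w: "\<And>x. x \<in> {0..l} \<Longrightarrow> (w has_vector_derivative w' x) (at x within {0..l})"
    and w': "continuous_on {0..l} w'" and x: "x \<in> {0..l}"
  shows "(w x)\<^sup>2 \<le> (w 0)\<^sup>2 + (w l)\<^sup>2 + l * integral {0..l} (\<lambda>x. (w' x)\<^sup>2)"
proof -
  define A B where "A = integral {0..x} (\<lambda>x. (w' x)\<^sup>2)" and "B = integral {x..l} (\<lambda>x. (w' x)\<^sup>2)"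
  have int: "(\<lambda>x. (w' x)\<^sup>2) integrable_on {0..l}"
    by (intro integrable_continuous_real continuous_intros w')
  have AB: "A + B = integral {0..l} (\<lambda>x. (w' x)\<^sup>2)"
    unfolding A_def B_def using x by (intro Henstock_Kurzweil_Integration.integral_combine int) auto
  have nonneg: "0 \<le> A" "0 \<le> B"
    unfolding A_def B_def using x
    by (auto intro!: integral_nonneg integrable_subinterval_real[OF int])
  have "(w x - w 0)\<^sup>2 \<le> (x - 0) * A"
    unfolding A_def using x
    by (intro square_increment_le has_vector_derivative_within_subset[OF w] continuous_on_subset[OF w']) auto
  moreover have "(w l - w x)\<^sup>2 \<le> (l - x) * B"
    unfolding B_def using x
    by (intro square_increment_le has_vector_derivative_within_subset[OF w] continuous_on_subset[OF w']) auto
  moreover have "x * A \<le> l * A" "(l - x) * B \<le> l * B"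
    using x nonneg by (auto intro!: mult_right_mono)
  \<comment> \<open>This is the sum of \<open>(w x)\<^sup>2 \<le> 2 * (w 0)\<^sup>2 + 2 * (w x - w
    0)\<^sup>2\<close> and its analogue at \<open>l\<close>.\<close>
  moreover have "2 * (w x)\<^sup>2 \<le> 2 * (w 0)\<^sup>2 + 2 * (w l)\<^sup>2 + 2 * (w x - w 0)\<^sup>2 + 2 * (w l - w x)\<^sup>2"
    using zero_le_power2[of "w x - 2 * w 0"] zero_le_power2[of "w x - 2 * w l"]
    by (simp add: power2_eq_square algebra_simps)
  ultimately show ?thesis
    unfolding AB[symmetric] by (simp add: distrib_left)
qed

lemma Young_two_mult:
  fixes a b e :: real
  assumes "0 < e"
  shows "2 * a * b \<le> e * a\<^sup>2 + b\<^sup>2 / e"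
proof -
  have "0 \<le> (e * a - b)\<^sup>2 / e" using assms by simp
  then show ?thesis using assms by (simp add: power2_eq_square field_simps)
qed

text \<open>At a frozen time, \<open>w\<close>, \<open>K\<close>, \<open>Q\<close>, \<open>G\<close>
  are the sections of u, k, q, f. The integrand on the left is \<open>w\<close> times the right-hand
  side of the equation, with the divergence term expanded by the product rule.\<close>

lemma Robin_energy_estimate:
  fixes l c1 b :: real and w w' w'' K K' Q G :: "real \<Rightarrow> real"
  assumes "l > 0" "c1 > 0" "b > 0"
    and w: "\<And>x. x \<in> {0..l} \<Longrightarrow> (w has_vector_derivative w' x) (at x within {0..l})"
    and w': "\<And>x. x \<in> {0..l} \<Longrightarrow> (w' has_vector_derivative w'' x) (at x within {0..l})"
    and K: "\<And>x. x \<in> {0..l} \<Longrightarrow> (K has_vector_derivative K' x) (at x within {0..l})"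
    and cont: "continuous_on {0..l} w''" "continuous_on {0..l} K'" "continuous_on {0..l} Q"
      "continuous_on {0..l} G"
    and K_ge: "\<And>x. x \<in> {0..l} \<Longrightarrow> K x \<ge> c1" and Q_ge: "\<And>x. x \<in> {0..l} \<Longrightarrow> Q x \<ge> 0"
    and b1: "b1 \<ge> b" and b2: "b2 \<ge> b"
    and bc0: "K 0 * w' 0 = b1 * w 0 - m1" and bcl: "- K l * w' l = b2 * w l - m2"
    and \<gamma>: "\<gamma> = min c1 b" and \<delta>: "\<delta> = max (1 + l) (l\<^sup>2)"
  shows "2 * integral {0..l} (\<lambda>x. w x * (K' x * w' x + K x * w'' x - Q x * w x + G x))
      + \<gamma> * (integral {0..l} (\<lambda>x. (w' x)\<^sup>2) + (w 0)\<^sup>2 + (w l)\<^sup>2)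
    \<le> \<delta> / \<gamma> * (integral {0..l} (\<lambda>x. (G x)\<^sup>2) + m1\<^sup>2 + m2\<^sup>2)"
proof -
  have cw: "continuous_on {0..l} w" "continuous_on {0..l} w'" "continuous_on {0..l} K"
    using w w' K by (meson continuous_on_eq_continuous_within has_vector_derivative_continuous)+
  define D where "D = integral {0..l} (\<lambda>x. (w' x)\<^sup>2)"
  define N where "N = integral {0..l} (\<lambda>x. (G x)\<^sup>2)"
  define S where "S = (w 0)\<^sup>2 + (w l)\<^sup>2"
  \<comment> \<open>With this Young parameter the terms in \<open>w\<close> cost at most
    \<open>e * \<delta> = \<gamma>\<close> times the energy, half of the available
    \<open>2 * \<gamma>\<close>, while the data receive the factor
    \<open>1 / e = \<delta> / \<gamma>\<close>.\<close>
  define e where "e = \<gamma> / \<delta>"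
  have pos: "\<gamma> > 0" "\<delta> > 0" "e > 0"
    using assms(1-3) by (auto simp: \<gamma> \<delta> e_def)
  have D0: "D \<ge> 0" "S \<ge> 0"
    unfolding D_def S_def by (auto intro!: integral_nonneg integrable_continuous_real continuous_intros cw)
  have int_D: "((\<lambda>x. (w' x)\<^sup>2) has_integral D) {0..l}" and int_N: "((\<lambda>x. (G x)\<^sup>2) has_integral N) {0..l}"
    unfolding D_def N_def
    by (intro integrable_integral integrable_continuous_real continuous_intros cw cont)+
  \<comment> \<open>Integration by parts, as the fundamental theorem for the product of
    \<open>w\<close> and the flux \<open>K x * w' x\<close>. The boundary conditions then turn the
    boundary term into data minus the squares at the ends.\<close>
  have "((\<lambda>x. w x * (K x * w'' x + K' x * w' x) + w' x * (K x * w' x)) has_integral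
      (w l * (K l * w' l) - w 0 * (K 0 * w' 0))) {0..l}"
    using assms(1)
    by (intro fundamental_theorem_of_calculus has_vector_derivative_mult w w' K) auto
  moreover have "w l * (K l * w' l) - w 0 * (K 0 * w' 0) = m1 * w 0 + m2 * w l - b1 * (w 0)\<^sup>2 - b2 * (w l)\<^sup>2"
    using bcl unfolding bc0 by (simp add: power2_eq_square algebra_simps)
  \<comment> \<open>The comparison is pointwise in \<open>x\<close>: \<open>S + l * D\<close>
    dominates \<open>(w x)\<^sup>2\<close>, \<open>K\<close> is at least \<open>\<gamma>\<close>,
    and the \<open>Q\<close> term has a favourable sign. Integrating the constant
    \<open>e * (S + l * D)\<close> produces the extra factor \<open>l\<close>.\<close>
  moreover have "integral {0..l} (\<lambda>x. w x * (K' x * w' x + K x * w'' x - Q x * w x + G x)) -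
      (w l * (K l * w' l) - w 0 * (K 0 * w' 0)) \<le> (e * (S + l * D) * l + N / e) / 2 - \<gamma> * D"
  proof (rule has_integral_le)
    show "((\<lambda>x. w x * (K' x * w' x + K x * w'' x - Q x * w x + G x) -
        (w x * (K x * w'' x + K' x * w' x) + w' x * (K x * w' x))) has_integral
        integral {0..l} (\<lambda>x. w x * (K' x * w' x + K x * w'' x - Q x * w x + G x)) -
        (w l * (K l * w' l) - w 0 * (K 0 * w' 0))) {0..l}"
      by (intro has_integral_diff calculation(1) integrable_integral integrable_continuous_real
          continuous_intros cw cont)
    have "((\<lambda>x. e * (S + l * D)) has_integral (e * (S + l * D) * l)) {0..l}"
      using has_integral_const_real[of "e * (S + l * D)" 0 l] assms(1) by (simp add: mult.commute)
    then show "((\<lambda>x. (e * (S + l * D) + (G x)\<^sup>2 / e) / 2 - \<gamma> * (w' x)\<^sup>2) has_integral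
        (e * (S + l * D) * l + N / e) / 2 - \<gamma> * D) {0..l}"
      by (intro has_integral_diff has_integral_divide has_integral_add has_integral_mult_right int_D int_N)
    show "w x * (K' x * w' x + K x * w'' x - Q x * w x + G x) -
        (w x * (K x * w'' x + K' x * w' x) + w' x * (K x * w' x))
      \<le> (e * (S + l * D) + (G x)\<^sup>2 / e) / 2 - \<gamma> * (w' x)\<^sup>2" if x: "x \<in> {0..l}" for x
    proof -
      have "(w x)\<^sup>2 \<le> S + l * D"
        unfolding S_def D_def by (intro square_le_endpoints w cw x)
      then have "e * (w x)\<^sup>2 \<le> e * (S + l * D)"
        using pos by (intro mult_left_mono) auto
      moreover have "2 * w x * G x \<le> e * (w x)\<^sup>2 + (G x)\<^sup>2 / e"
        using pos by (intro Young_two_mult)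
      moreover have "\<gamma> * (w' x)\<^sup>2 \<le> K x * (w' x)\<^sup>2"
        using K_ge[OF x] by (intro mult_right_mono) (auto simp: \<gamma>)
      moreover have "0 \<le> Q x * (w x)\<^sup>2"
        using Q_ge[OF x] by auto
      ultimately show ?thesis
        by (simp add: power2_eq_square algebra_simps)
    qed
  qed
  ultimately have main: "2 * integral {0..l} (\<lambda>x. w x * (K' x * w' x + K x * w'' x - Q x * w x + G x)) \<le>
      2 * (m1 * w 0) + 2 * (m2 * w l) - 2 * (b1 * (w 0)\<^sup>2) - 2 * (b2 * (w l)\<^sup>2)
      + e * (S + l * D) * l + N / e - 2 * (\<gamma> * D)"
    by argo
  have e_\<delta>: "e * \<delta> = \<gamma>" "\<delta> / \<gamma> = 1 / e"
    using pos by (auto simp: e_def)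
  have "2 * (m1 * w 0) \<le> e * (w 0)\<^sup>2 + m1\<^sup>2 / e" "2 * (m2 * w l) \<le> e * (w l)\<^sup>2 + m2\<^sup>2 / e"
    using pos Young_two_mult[of e "w 0" m1] Young_two_mult[of e "w l" m2] by (auto simp: mult_ac)
  moreover have "\<gamma> * (w 0)\<^sup>2 \<le> b1 * (w 0)\<^sup>2" "\<gamma> * (w l)\<^sup>2 \<le> b2 * (w l)\<^sup>2"
    using b1 b2 by (auto simp: \<gamma> intro!: mult_right_mono)
  \<comment> \<open>The endpoint squares carry \<open>1 + l\<close>, from the boundary Young terms
    and the pointwise bound, and \<open>D\<close> carries \<open>l\<^sup>2\<close>. The maximum
    \<open>\<delta>\<close> covers both.\<close>
  moreover have "e * (w 0)\<^sup>2 + e * (w l)\<^sup>2 + e * (S + l * D) * l \<le> \<gamma> * (w 0)\<^sup>2 + \<gamma> * (w l)\<^sup>2 + \<gamma> * D"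
  proof -
    have "e * ((1 + l) * S + l\<^sup>2 * D) \<le> e * (\<delta> * S + \<delta> * D)"
      using pos D0 by (auto simp: \<delta> intro!: mult_left_mono mult_right_mono add_mono)
    also have "\<dots> = \<gamma> * S + \<gamma> * D"
      by (simp add: distrib_left flip: mult.assoc e_\<delta>(1))
    finally show ?thesis
      by (simp add: S_def power2_eq_square algebra_simps)
  qed
  moreover have "\<gamma> * (D + (w 0)\<^sup>2 + (w l)\<^sup>2) = \<gamma> * D + \<gamma> * (w 0)\<^sup>2 + \<gamma> * (w l)\<^sup>2"
    by (simp add: distrib_left)
  moreover have "\<delta> / \<gamma> * (N + m1\<^sup>2 + m2\<^sup>2) = N / e + m1\<^sup>2 / e + m2\<^sup>2 / e"
    by (simp add: e_\<delta> add_divide_distrib)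
  ultimately show ?thesis
    using main unfolding D_def[symmetric] N_def[symmetric] by argo
qed

section \<open>Calculus in the classes of the solution and coefficients, and integrals with a
  parameter\<close>

lemma C_class_x_derivative:
  assumes "u \<in> C_class l T m n" "i < m" "x \<in> {0..l}" "t \<in> {0..T}"
  shows "((\<lambda>y. (Dx l ^^ i) u y t) has_vector_derivative (Dx l ^^ Suc i) u x t) (at x within {0..l})"
  using assms by (auto simp: C_class_def rect_def Dx_def vector_derivative_works[symmetric])

lemma C_class_t_derivative:
  assumes "u \<in> C_class l T m n" "j < n" "x \<in> {0..l}" "t \<in> {0..T}"
  shows "((\<lambda>s. (Dt T ^^ j) u x s) has_vector_derivative (Dt T ^^ Suc j) u x t) (at t within {0..T})"
  using assms by (auto simp: C_class_def rect_def Dt_def vector_derivative_works[symmetric])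

lemma C_class_x_continuous:
  assumes "u \<in> C_class l T m n" "i \<le> m"
  shows "continuous_on ({0..l} \<times> {0..T}) (\<lambda>(x, t). (Dx l ^^ i) u x t)"
  using assms by (auto simp: C_class_def rect_def)

lemma C_class_t_continuous:
  assumes "u \<in> C_class l T m n" "j \<le> n"
  shows "continuous_on ({0..l} \<times> {0..T}) (\<lambda>(x, t). (Dt T ^^ j) u x t)"
  using assms by (auto simp: C_class_def rect_def)

lemma continuous_on_integral_fst:
  fixes g :: "real \<Rightarrow> real \<Rightarrow> real"
  assumes "continuous_on ({0..l} \<times> {0..t}) (\<lambda>(x, s). g x s)"
  shows "continuous_on {0..t} (\<lambda>s. integral {0..l} (\<lambda>x. g x s))"
proof -
  have "continuous_on ({0..t} \<times> cbox 0 l) (\<lambda>(s, x). g x s)"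
    using swap_continuous[of 0 0 l t] assms by (simp add: cbox_Pair_eq)
  from integral_continuous_on_param[OF this] show ?thesis by simp
qed

lemma integral_swap_real:
  fixes g :: "real \<Rightarrow> real \<Rightarrow> real"
  assumes "continuous_on ({0..l} \<times> {0..t}) (\<lambda>(x, s). g x s)"
  shows "integral {0..l} (\<lambda>x. integral {0..t} (g x)) = integral {0..t} (\<lambda>s. integral {0..l} (\<lambda>x. g x s))"
  using integral_swap_continuous[of 0 0 l t g] assms by (simp add: cbox_Pair_eq)

section \<open>The a priori estimate from the time and space inequalities\<close>

theorem theorem2:
  fixes l T c1 \<beta>0 :: real
    and \<alpha> \<beta>1 \<beta>2 \<mu>1 \<mu>2 u0 :: "real \<Rightarrow> real"
    and k q f u :: "real \<Rightarrow> real \<Rightarrow> real"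
  assumes "l > 0" and "T > 0"
    and "continuous_on {0<..<l} \<alpha>" and "\<And>x. x \<in> {0<..<l} \<Longrightarrow> \<alpha> x \<in> {0<..<1}"
    and "k \<in> C_class l T 1 0"
    and "continuous_on (rect l T) (\<lambda>(x, t). q x t)"
    and "continuous_on (rect l T) (\<lambda>(x, t). f x t)"
    and "c1 > 0" and "\<And>x t. (x, t) \<in> rect l T \<Longrightarrow> k x t \<ge> c1"
    and "\<And>x t. (x, t) \<in> rect l T \<Longrightarrow> q x t \<ge> 0"
    and "continuous_on {0..T} \<beta>1" and "continuous_on {0..T} \<beta>2"
    and "continuous_on {0..T} \<mu>1" and "continuous_on {0..T} \<mu>2"
    and "\<beta>0 > 0"
    and "\<And>t. t \<in> {0..T} \<Longrightarrow> \<beta>1 t \<ge> \<beta>0" and "\<And>t. t \<in> {0..T} \<Longrightarrow> \<beta>2 t \<ge> \<beta>0"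
    and "u \<in> C_class l T 2 1"
    and "\<And>x t. 0 < x \<Longrightarrow> x < l \<Longrightarrow> 0 < t \<Longrightarrow> t \<le> T \<Longrightarrow>
           caputo T \<alpha> u x t = Dx l (\<lambda>y s. k y s * Dx l u y s) x t - q x t * u x t + f x t"
    and "\<And>t. t \<in> {0..T} \<Longrightarrow> k 0 t * Dx l u 0 t = \<beta>1 t * u 0 t - \<mu>1 t"
    and "\<And>t. t \<in> {0..T} \<Longrightarrow> - k l t * Dx l u l t = \<beta>2 t * u l t - \<mu>2 t"
    and "\<And>x. x \<in> {0..l} \<Longrightarrow> u x 0 = u0 x"
  shows "\<forall>t\<in>{0..T}.
    (let \<gamma> = min c1 \<beta>0; \<delta> = max (1 + l) (l\<^sup>2) in
      integral {0..l} (\<lambda>x. RL_integral (\<lambda>x. 1 - \<alpha> x) (\<lambda>x s. (u x s)\<^sup>2) x t)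
      + \<gamma> * integral {0..t} (\<lambda>s. norm0_sq l (Dx l u) s + (u 0 s)\<^sup>2 + (u l s)\<^sup>2)
      \<le> \<delta> / \<gamma> * integral {0..t} (\<lambda>s. norm0_sq l f s + (\<mu>1 s)\<^sup>2 + (\<mu>2 s)\<^sup>2)
        + integral {0..l} (\<lambda>x. t powr (1 - \<alpha> x) / Gamma (2 - \<alpha> x) * (u0 x)\<^sup>2))"
proof
  note l = \<open>l > 0\<close> and \<alpha>_cont = assms(3) and \<alpha> = assms(4) and k = assms(5) and q = assms(6)
    and f = assms(7) and c1 = \<open>c1 > 0\<close> and k_ge = assms(9) and q_ge = assms(10)
    and \<mu> = assms(13,14) and \<beta>0 = \<open>\<beta>0 > 0\<close> and \<beta> = assms(16,17) and u = assms(18)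
    and eq = assms(19) and bc = assms(20,21) and ini = assms(22)
  fix t assume t: "t \<in> {0..T}"
  define \<gamma> \<delta> where "\<gamma> = min c1 \<beta>0" and "\<delta> = max (1 + l) (l\<^sup>2)"
  define ux uxx ut kx where "ux = Dx l u" and "uxx = Dx l ux" and "ut = Dt T u" and "kx = Dx l k"
  \<comment> \<open>\<open>F\<close> is the right-hand side of the equation with the divergence
    expanded. It is continuous on the closed rectangle and replaces the Caputo derivative, to which
    it is tied only for interior \<open>x\<close> and positive times.\<close>
  define F where "F x s = kx x s * ux x s + k x s * uxx x s - q x s * u x s + f x s" for x s
  have du: "((\<lambda>y. u y s) has_vector_derivative ux x s) (at x within {0..l})"
    and dux: "((\<lambda>y. ux y s) has_vector_derivative uxx x s) (at x within {0..l})"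
    and dk: "((\<lambda>y. k y s) has_vector_derivative kx x s) (at x within {0..l})"
    and dut: "(u x has_vector_derivative ut x s) (at s within {0..T})"
    if "x \<in> {0..l}" "s \<in> {0..T}" for x s
    using C_class_x_derivative[OF u, of 0] C_class_x_derivative[OF u, of 1]
      C_class_x_derivative[OF k, of 0] C_class_t_derivative[OF u, of 0] that
    by (auto simp: ux_def uxx_def ut_def kx_def)
  have sub: "{0..l} \<times> {0..t} \<subseteq> {0..l} \<times> {0..T}"
    using t by auto
  have "continuous_on ({0..l} \<times> {0..T}) (\<lambda>(x, s). u x s)"
    "continuous_on ({0..l} \<times> {0..T}) (\<lambda>(x, s). ux x s)"
    "continuous_on ({0..l} \<times> {0..T}) (\<lambda>(x, s). uxx x s)"
    "continuous_on ({0..l} \<times> {0..T}) (\<lambda>(x, s). ut x s)"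
    "continuous_on ({0..l} \<times> {0..T}) (\<lambda>(x, s). k x s)"
    "continuous_on ({0..l} \<times> {0..T}) (\<lambda>(x, s). kx x s)"
    "continuous_on ({0..l} \<times> {0..T}) (\<lambda>(x, s). q x s)"
    "continuous_on ({0..l} \<times> {0..T}) (\<lambda>(x, s). f x s)"
    using C_class_x_continuous[OF u, of 0] C_class_x_continuous[OF u, of 1]
      C_class_x_continuous[OF u, of 2] C_class_t_continuous[OF u, of 1]
      C_class_x_continuous[OF k, of 0] C_class_x_continuous[OF k, of 1] q f
    by (auto simp: ux_def uxx_def ut_def kx_def rect_def numeral_2_eq_2)
  note cont = this[THEN continuous_on_subset, OF sub]
  have cF: "continuous_on ({0..l} \<times> {0..t}) (\<lambda>(x, s). u x s * F x s)"
    using cont unfolding F_def case_prod_unfold by (intro continuous_intros)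
  have caputo_eq: "F x s = 1 / Gamma (1 - \<alpha> x) * integral {0..s} (\<lambda>\<tau>. ut x \<tau> * (s - \<tau>) powr - \<alpha> x)"
    if "x \<in> {0<..<l}" "s \<in> {0<..t}" for x s
  proof -
    have "((\<lambda>y. k y s * ux y s) has_vector_derivative k x s * uxx x s + kx x s * ux x s) (at x within {0..l})"
      using that t by (intro has_vector_derivative_mult dk dux) auto
    then have "Dx l (\<lambda>y s. k y s * ux y s) x s = k x s * uxx x s + kx x s * ux x s"
      unfolding Dx_def
      using that l by (intro vector_derivative_within_closed_interval) auto
    then show ?thesis
      using eq[of x s, folded ux_def] that t by (simp add: caputo_def F_def ut_def)
  qed
  define E where "E s = norm0_sq l (Dx l u) s + (u 0 s)\<^sup>2 + (u l s)\<^sup>2" for s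
  define R where "R s = norm0_sq l f s + (\<mu>1 s)\<^sup>2 + (\<mu>2 s)\<^sup>2" for s
  define W where "W s = integral {0..l} (\<lambda>x. u x s * F x s)" for s
  have cont_W: "continuous_on {0..t} W"
    unfolding W_def by (rule continuous_on_integral_fst[OF cF])
  have "continuous_on ({0..l} \<times> {0..t}) (\<lambda>(x, s). (ux x s)\<^sup>2)"
    "continuous_on ({0..l} \<times> {0..t}) (\<lambda>(x, s). (f x s)\<^sup>2)"
    using cont unfolding case_prod_unfold by (auto intro!: continuous_intros)
  note norm_cont = this[THEN continuous_on_integral_fst]
  have cont_E: "continuous_on {0..t} E" and cont_R: "continuous_on {0..t} R"
    unfolding E_def R_def norm0_sq_def ux_def[symmetric] using t l
    by (auto intro!: continuous_intros norm_cont continuous_on_section(1)[OF cont(1)]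
        continuous_on_subset[OF \<mu>(1)] continuous_on_subset[OF \<mu>(2)])
  \<comment> \<open>The spatial estimate is applied at each time of the closed interval, since
    \<open>F\<close> and the boundary conditions make sense at \<open>s = 0\<close> too.\<close>
  have energy: "2 * W s + \<gamma> * E s \<le> \<delta> / \<gamma> * R s" if "s \<in> {0..t}" for s
    unfolding W_def E_def R_def norm0_sq_def F_def ux_def[symmetric]
  proof (rule Robin_energy_estimate[OF l c1 \<beta>0, where ?b1.0 = "\<beta>1 s" and ?b2.0 = "\<beta>2 s"])
    show "continuous_on {0..l} (\<lambda>x. uxx x s)" "continuous_on {0..l} (\<lambda>x. kx x s)"
      "continuous_on {0..l} (\<lambda>x. q x s)" "continuous_on {0..l} (\<lambda>x. f x s)"
      using that by (auto intro: cont[THEN continuous_on_section(2)])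
  qed (use that t bc[of s] \<beta>[of s] k_ge q_ge in
      \<open>auto simp: \<gamma>_def \<delta>_def ux_def rect_def intro: du[unfolded ux_def] dux[unfolded ux_def] dk\<close>)
  have space: "2 * integral {0..t} W + \<gamma> * integral {0..t} E \<le> \<delta> / \<gamma> * integral {0..t} R"
  proof -
    have "integral {0..t} (\<lambda>s. 2 * W s + \<gamma> * E s) \<le> integral {0..t} (\<lambda>s. \<delta> / \<gamma> * R s)"
      by (intro integral_le integrable_continuous_real continuous_intros cont_W cont_E cont_R energy)
    also have "integral {0..t} (\<lambda>s. 2 * W s + \<gamma> * E s) = integral {0..t} (\<lambda>s. 2 * W s) + integral {0..t} (\<lambda>s. \<gamma> * E s)"
      by (intro integral_add integrable_continuous_real continuous_intros cont_W cont_E)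
    finally show ?thesis by simp
  qed
  define P where "P x = t powr (1 - \<alpha> x) / Gamma (2 - \<alpha> x) * (u0 x)\<^sup>2" for x
  let ?RL = "\<lambda>x. RL_integral (\<lambda>x. 1 - \<alpha> x) (\<lambda>x s. (u x s)\<^sup>2) x t"
  have time: "integral {0..l} ?RL \<le> integral {0..l} P + 2 * integral {0..t} W"
  proof (cases "t = 0")
    \<comment> \<open>All three integrals vanish: two run over a single time, and
      \<open>0 powr (1 - \<alpha> x) = 0\<close> in \<open>P\<close>.\<close>
    case True
    then show ?thesis by (simp add: RL_integral_def P_def[abs_def])
  next
    case False
    with t have t0: "0 < t" by simp
    let ?V = "\<lambda>x. integral {0..t} (\<lambda>s. u x s * F x s)"
    have "continuous_on {0..l} ?V"
      using integral_continuous_on_param[of "{0..l}" 0 t "\<lambda>x s. u x s * F x s"] cF by simp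
    then have int_V: "(\<lambda>x. 2 * ?V x) integrable_on {0..l}"
      by (intro integrable_continuous_real continuous_intros)
    have u0_cont: "continuous_on {0..l} (\<lambda>x. u x 0)"
      using t by (intro continuous_on_section(2)[OF cont(1)]) auto
    \<comment> \<open>Continuity of the initial data in \<open>x\<close> comes from the trace
      \<open>u x 0\<close>.\<close>
    have int_P: "P integrable_on {0..l}"
    proof -
      have "(\<lambda>x. t powr (1 - \<alpha> x) / Gamma (2 - \<alpha> x) * (u x 0)\<^sup>2) integrable_on {0..l}"
        by (intro integrable_powr_div_Gamma \<alpha>_cont \<alpha> t0 continuous_intros u0_cont)
      then show ?thesis
        by (rule integrable_eq) (simp add: P_def ini)
    qed
    have int_RL: "?RL integrable_on {0..l}"
    proof (rule RL_integral_integrable[OF \<alpha>_cont \<alpha> t0])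
      show "((\<lambda>s. (u x s)\<^sup>2) has_vector_derivative 2 * (u x s * ut x s)) (at s within {0..t})"
        if "x \<in> {0..l}" "s \<in> {0..t}" for x s
      proof -
        have "(u x has_vector_derivative ut x s) (at s within {0..t})"
          using that t by (intro has_vector_derivative_within_subset[OF dut]) auto
        from has_vector_derivative_mult[OF this this] show ?thesis
          by (simp add: power2_eq_square mult.commute)
      qed
      show "continuous_on ({0..l} \<times> {0..t}) (\<lambda>(x, s). 2 * (u x s * ut x s))"
        using cont unfolding case_prod_unfold by (intro continuous_intros)
    qed (auto intro!: continuous_intros u0_cont)
    \<comment> \<open>The inequality in time holds for each \<open>x\<close> in the open interval,
      where \<alpha> takes values in (0, 1) and the equation is given.\<close>
    have "integral {0<..<l} ?RL \<le> integral {0<..<l} (\<lambda>x. P x + 2 * ?V x)"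
    proof (rule integral_le)
      show "?RL x \<le> P x + 2 * ?V x" if x: "x \<in> {0<..<l}" for x
      proof -
        have x': "x \<in> {0..l}" using x by auto
        have "1 / Gamma (1 - \<alpha> x) * integral {0..t} (\<lambda>s. (t - s) powr - \<alpha> x * (u x s)\<^sup>2)
          \<le> t powr (1 - \<alpha> x) / Gamma (2 - \<alpha> x) * (u x 0)\<^sup>2 + 2 * ?V x"
        proof (rule caputo_energy_ge)
          show "(u x has_vector_derivative ut x s) (at s within {0..t})" if "s \<in> {0..t}" for s
            using that t x by (intro has_vector_derivative_within_subset[OF dut]) auto
          show "(\<lambda>s. u x s * F x s) integrable_on {0..t}"
            by (intro integrable_continuous_real continuous_on_section(1)[OF cF] x')
        qed (use \<alpha>[OF x] t0 x x' caputo_eq continuous_on_section(1)[OF cont(4)] in auto)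
        then show ?thesis
          using ini[OF x'] by (simp add: RL_integral_def P_def)
      qed
    qed (use int_RL int_P int_V in \<open>auto simp: integrable_on_open_interval_real intro: integrable_add\<close>)
    also have "integral {0<..<l} (\<lambda>x. P x + 2 * ?V x) = integral {0..l} P + integral {0..l} (\<lambda>x. 2 * ?V x)"
      unfolding integral_open_interval_real[symmetric] by (intro integral_add int_P int_V)
    \<comment> \<open>The swap of integrals turns the time inequality's remainder into the quantity
      that the spatial estimate controls.\<close>
    also have "integral {0..l} (\<lambda>x. 2 * ?V x) = 2 * integral {0..t} W"
      using integral_swap_real[OF cF] by (simp add: W_def[abs_def])
    finally show ?thesis
      by (simp add: integral_open_interval_real)
  qed
  \<comment> \<open>Adding \<open>time\<close> and \<open>space\<close> cancels
    \<open>2 * integral {0..t} W\<close>.\<close>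
  show "let \<gamma> = min c1 \<beta>0; \<delta> = max (1 + l) (l\<^sup>2) in
      integral {0..l} ?RL
      + \<gamma> * integral {0..t} (\<lambda>s. norm0_sq l (Dx l u) s + (u 0 s)\<^sup>2 + (u l s)\<^sup>2)
      \<le> \<delta> / \<gamma> * integral {0..t} (\<lambda>s. norm0_sq l f s + (\<mu>1 s)\<^sup>2 + (\<mu>2 s)\<^sup>2)
        + integral {0..l} (\<lambda>x. t powr (1 - \<alpha> x) / Gamma (2 - \<alpha> x) * (u0 x)\<^sup>2)"
    using time space unfolding Let_def \<gamma>_def[symmetric] \<delta>_def[symmetric] E_def[abs_def] R_def[abs_def] P_def[abs_def] by linarith
qed

end
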